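(* Let $n\ge 3$, $b>2$, and let $\widetilde b\in\mathbb{R}$ be such that $\widetilde T_n$ is nonsingular. Then for every $1\le i\le n$ the sum of the entries in the $i$-th row of $\widetilde T_n^{-1}$ is $$\sum_{j=1}^n\widetilde t^{-1}_{i,j}=\frac{1}{b-2}+\frac{b-\widetilde b-1}{b-2}\cdot\frac{\gamma_i+\gamma_{n+1-i}}{\gamma_{n+1}+(\widetilde b-b)(\gamma_n+\gamma_1)}.$$
   Context: For an integer $n\ge 3$ and real $b,\widetilde b$, $\widetilde T_n$ is the $n\times n$ real symmetric tridiagonal matrix with diagonal entries $(\widetilde b,b,b,\dots,b,\widetilde b)$ (first and last equal to $\widetilde b$, all others equal to $b$) and all sub- and superdiagonal entries equal to $-1$. $\widetilde t^{-1}_{i,j}$ denotes the $(i,j)$ entry of $\widetilde T_n^{-1}$. For $b>2$ put $r_1=\tfrac12(b+\sqrt{b^2-4})$, $r_2=\tfrac12(b-\sqrt{b^2-4})$ and $\gamma_k=r_1^k-r_2^k$. *)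

theory Defs
  imports Complex_Main "Jordan_Normal_Form.Gauss_Jordan_Elimination"
begin

(* Matrices from Jordan_Normal_Form are indexed from 0, so the corner entries of the
   diagonal sit at positions 0 and n - 1. The parameter bt stands for b-tilde. *)
definition T_tilde :: "nat \<Rightarrow> real \<Rightarrow> real \<Rightarrow> real mat" where
  "T_tilde n b bt = mat n n (\<lambda>(i, j).
     if i = j then (if i = 0 \<or> i = n - 1 then bt else b)
     else if i = Suc j \<or> j = Suc i then - 1
     else 0)"

(* Entry (i, j) of the inverse in the usual indexing 1..n; meaningful only for
   invertible T_tilde n b bt, since mat_inverse is None for singular matrices. *)
definition t_tilde_inv :: "nat \<Rightarrow> real \<Rightarrow> real \<Rightarrow> nat \<Rightarrow> nat \<Rightarrow> real" where
  "t_tilde_inv n b bt i j = the (mat_inverse (T_tilde n b bt)) $$ (i - 1, j - 1)"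

definition r1 :: "real \<Rightarrow> real" where
  "r1 b = 1 / 2 * (b + sqrt (b ^ 2 - 4))"

definition r2 :: "real \<Rightarrow> real" where
  "r2 b = 1 / 2 * (b - sqrt (b ^ 2 - 4))"

definition gam :: "real \<Rightarrow> nat \<Rightarrow> real" where
  "gam b k = r1 b ^ k - r2 b ^ k"

end

(* The sequence s k = gam k + gam (n + 1 - k) solves s (k + 2) - b s (k + 1) + s k = 0, so applying
   T_tilde to (s 1, ..., s n) gives the vector D (e_1 + e_n), where D is the denominator of the
   claimed formula. Hence D = 0 would contradict nonsingularity, and the claimed row sums form the
   solution x of T_tilde x = (1, ..., 1). *)
theory Submission
  imports Defs
begin

lemma gam_0 [simp]: "gam b 0 = 0"
  by (simp add: gam_def)

lemma r1_plus_r2: "r1 b + r2 b = b"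
  by (simp add: r1_def r2_def field_simps)

lemma r1_times_r2:
  assumes "b \<ge> 2"
  shows "r1 b * r2 b = 1"
proof -
  have "b ^ 2 \<ge> 4"
    using power_mono[of 2 b 2] assms by simp
  then have "(sqrt (b ^ 2 - 4)) ^ 2 = b ^ 2 - 4"
    by simp
  moreover have "1 / 2 * (b + q) * (1 / 2 * (b - q)) = (b ^ 2 - q ^ 2) / 4" for q
    by (simp add: field_simps power2_eq_square)
  then have "r1 b * r2 b = (b ^ 2 - (sqrt (b ^ 2 - 4)) ^ 2) / 4"
    unfolding r1_def r2_def .
  ultimately show ?thesis
    by simp
qed

text \<open>\<open>r1 b\<close> and \<open>r2 b\<close> have sum \<open>b\<close> and product 1, so
  both are roots of x^2 = b x - 1, and any combination of their powers obeys the resulting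
  recurrence.\<close>

lemma gam_rec:
  assumes "b \<ge> 2"
  shows "gam b (Suc (Suc k)) = b * gam b (Suc k) - gam b k"
proof -
  \<comment> \<open>The hypothesis is symmetric in the two roots, so one argument serves
    both.\<close>
  have root: "x ^ Suc (Suc k) = b * x ^ Suc k - x ^ k"
    if "x = r1 b \<and> y = r2 b \<or> x = r2 b \<and> y = r1 b" for x y
  proof -
    have "x + y = b" "x * y = 1"
      using that r1_plus_r2[of b] r1_times_r2[OF assms] by (auto simp: algebra_simps)
    then have "x * x = b * x - 1"
      by (metis add_diff_cancel_right' mult.commute distrib_right)
    then have "x * x * x ^ k = (b * x - 1) * x ^ k"
      by simp
    then show ?thesis
      by (simp add: algebra_simps)
  qed
  show ?thesis
    using root[of "r1 b" "r2 b"] root[of "r2 b" "r1 b"]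
    by (simp add: gam_def algebra_simps)
qed

text \<open>For b > 2 the roots satisfy 0 \<le> \<open>r2 b\<close> < \<open>r1 b\<close>. This
  makes the first entry of the vector \<open>s\<close> in the main proof nonzero.\<close>

lemma gam_pos:
  assumes "b > 2" and "k > 0"
  shows "gam b k > 0"
proof -
  have "b ^ 2 > 4"
    using power_strict_mono[of 2 b 2] assms by simp
  then have "r2 b < r1 b"
    by (simp add: r1_def r2_def)
  \<comment> \<open>The product 1 forces the roots to share a sign, and their sum is
    positive.\<close>
  moreover have "0 \<le> r2 b"
    using r1_times_r2[of b] assms \<open>r2 b < r1 b\<close> r1_plus_r2[of b]
    by (smt (verit) mult_nonneg_nonpos)
  ultimately show ?thesis
    using assms power_strict_mono[of "r2 b" "r1 b" k] by (simp add: gam_def)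
qed

lemma T_tilde_carrier [simp]: "T_tilde n b bt \<in> carrier_mat n n"
  by (simp add: T_tilde_def)

lemma T_tilde_mult_vec_index:
  assumes "i < n"
  shows "(T_tilde n b bt *\<^sub>v vec n f) $ i =
    (if i = 0 \<or> i = n - 1 then bt else b) * f i
      - (if i = 0 then 0 else f (i - 1)) - (if Suc i < n then f (Suc i) else 0)"
proof -
  define d where "d = (if i = 0 \<or> i = n - 1 then bt else b)"
  have "(T_tilde n b bt *\<^sub>v vec n f) $ i =
      (\<Sum>j<n. T_tilde n b bt $$ (i, j) * f j)"
    using assms by (simp add: T_tilde_def scalar_prod_def atLeast0LessThan)
  \<comment> \<open>One indicator term per diagonal. The inner test \<open>i = 0\<close> is needed
    because \<open>i - 1\<close> truncates to 0 and would produce a spurious left neighbour.\<close>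
  also have "\<dots> = (\<Sum>j<n. (if j = i then d * f j else 0)
      - (if j = i - 1 then if i = 0 then 0 else f j else 0) - (if j = Suc i then f j else 0))"
    using assms by (intro sum.cong) (auto simp: T_tilde_def d_def)
  also have "\<dots> = d * f i - (if i = 0 then 0 else f (i - 1)) - (if Suc i < n then f (Suc i) else 0)"
    using assms by (simp add: sum_subtractf sum.delta)
  finally show ?thesis
    by (simp add: d_def)
qed

text \<open>An interior row has two neighbours, a corner row only one. The sum is split so that the
  deviation from the constant \<open>b - 2\<close> sits in the corner rows alone.\<close>

lemma T_tilde_mult_const:
  assumes "n \<ge> 2" and "i < n"
  shows "(T_tilde n b bt *\<^sub>v vec n (\<lambda>_. 1)) $ i =
    (b - 2) + (if i = 0 \<or> i = n - 1 then bt + 1 - b else 0)"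
  using assms by (auto simp: T_tilde_mult_vec_index)

text \<open>The recurrence annihilates interior rows. In the first row the missing neighbour would
  have been gam 0 + gam (n + 1) = gam (n + 1), which therefore remains, together with the change of
  the diagonal from \<open>b\<close> to \<open>bt\<close>; the last row is its mirror image.\<close>

lemma T_tilde_mult_gam:
  assumes "n \<ge> 2" and "b \<ge> 2" and "i < n"
  shows "(T_tilde n b bt *\<^sub>v vec n (\<lambda>j. gam b (Suc j) + gam b (n - j))) $ i =
    (if i = 0 \<or> i = n - 1 then gam b (n + 1) + (bt - b) * (gam b n + gam b 1) else 0)"
proof -
  obtain m where m: "n = Suc (Suc m)"
    using assms(1) by (metis add_2_eq_Suc le_Suc_ex)
  consider "i = 0" | "i = Suc m" | k where "i = Suc k" "k < m"
    using assms(3) m by (cases i) (auto simp: less_Suc_eq)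
  then show ?thesis
  proof cases
    case 1
    then show ?thesis
      using gam_rec[OF assms(2), of 0] gam_rec[OF assms(2), of m] gam_rec[OF assms(2), of "Suc m"]
      by (simp add: T_tilde_mult_vec_index m algebra_simps)
  next
    case 2
    then show ?thesis
      using gam_rec[OF assms(2), of 0] gam_rec[OF assms(2), of m] gam_rec[OF assms(2), of "Suc m"]
      by (simp add: T_tilde_mult_vec_index m numeral_2_eq_2 algebra_simps)
  next
    case (3 k)
    \<comment> \<open>With \<open>l\<close> the reversed indices become l + 3, l + 2, l + 1, free of
      truncated subtraction.\<close>
    then obtain l where l: "m = Suc (k + l)"
      using less_iff_Suc_add by auto
    show ?thesis
      using gam_rec[OF assms(2), of "Suc k"] gam_rec[OF assms(2), of "Suc l"]
      by (simp add: T_tilde_mult_vec_index m 3 l Suc_diff_le algebra_simps)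
  qed
qed

text \<open>\<open>mat_inverse\<close> is specified through the units of the matrix ring, so
  invertibility is transferred there to exclude \<open>None\<close>. The shape of the inverse
  \<open>B\<close> has to be read off from the two products first.\<close>

lemma mat_inverse_invertible:
  fixes A :: "'a :: field mat"
  assumes A: "A \<in> carrier_mat n n" and "invertible_mat A"
  shows "the (mat_inverse A) \<in> carrier_mat n n" and "the (mat_inverse A) * A = 1\<^sub>m n"
proof -
  from assms(2) obtain B where AB: "A * B = 1\<^sub>m n" "B * A = 1\<^sub>m (dim_row B)"
    using A by (auto simp: invertible_mat_def inverts_mat_def)
  have "dim_col B = n"
    using AB(1) by (metis index_mult_mat(3) index_one_mat(3))
  moreover have "dim_row B = n"
    using AB(2) A by (metis carrier_matD(2) index_mult_mat(3) index_one_mat(3))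
  ultimately have "B \<in> carrier_mat n n"
    by auto
  then have "A \<in> Units (ring_mat TYPE('a) n ())"
    using A AB by (auto simp: Units_def ring_mat_simps)
  then obtain C where "mat_inverse A = Some C"
    using mat_inverse(1)[OF A, of "()"] by (cases "mat_inverse A") auto
  then show "the (mat_inverse A) \<in> carrier_mat n n" and "the (mat_inverse A) * A = 1\<^sub>m n"
    using mat_inverse(2)[OF A] by auto
qed

theorem mainTheorem4:
  fixes n i :: nat and b bt :: real
  assumes "n \<ge> 3"
    and "b > 2"
    and "invertible_mat (T_tilde n b bt)"
    and "1 \<le> i" and "i \<le> n"
  shows "(\<Sum>j = 1..n. t_tilde_inv n b bt i j) =
    1 / (b - 2) + (b - bt - 1) / (b - 2) *
      ((gam b i + gam b (n + 1 - i)) / (gam b (n + 1) + (bt - b) * (gam b n + gam b 1)))"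
proof -
  define T where "T = T_tilde n b bt"
  define M where "M = the (mat_inverse T)"
  define D where "D = gam b (n + 1) + (bt - b) * (gam b n + gam b 1)"
  \<comment> \<open>Chosen so that \<open>c * D\<close> cancels the corner deviation of
    \<open>T\<close> applied to the all-ones vector, after scaling by 1 / (b - 2).\<close>
  define c where "c = (b - bt - 1) / ((b - 2) * D)"
  define s where "s = vec n (\<lambda>j. gam b (Suc j) + gam b (n - j))"
  define u :: "real vec" where "u = vec n (\<lambda>_. 1)"
  have T: "T \<in> carrier_mat n n" and s: "s \<in> carrier_vec n" and u: "u \<in> carrier_vec n"
    by (auto simp: T_def s_def u_def)
  have M: "M \<in> carrier_mat n n" and MT: "M * T = 1\<^sub>m n"
    using mat_inverse_invertible[OF T] assms(3) by (auto simp: M_def T_def)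
  have M_T: "M *\<^sub>v (T *\<^sub>v v) = v" if "v \<in> carrier_vec n" for v
    using assoc_mult_mat_vec[OF M T that] MT that by simp
  have Ts: "(T *\<^sub>v s) $ k = (if k = 0 \<or> k = n - 1 then D else 0)" if "k < n" for k
    using T_tilde_mult_gam[of n b k bt] that assms by (simp add: T_def s_def D_def)
  have Tu: "(T *\<^sub>v u) $ k = (b - 2) + (if k = 0 \<or> k = n - 1 then bt + 1 - b else 0)"
    if "k < n" for k
    using T_tilde_mult_const[of n k b bt] that assms by (simp add: T_def u_def)
  have "D \<noteq> 0"
  proof
    assume "D = 0"
    then have "T *\<^sub>v s = 0\<^sub>v n"
      using Ts T by (intro eq_vecI) auto
    then have "s = M *\<^sub>v 0\<^sub>v n"
      using M_T[OF s] by simp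
    also have "\<dots> = 0\<^sub>v n"
      using M by auto
    finally have "s $ 0 = 0"
      using assms(1) by simp
    then show False
      using gam_pos[OF assms(2), of 1] gam_pos[OF assms(2), of n] assms(1) by (simp add: s_def)
  qed
  define x where "x = (1 / (b - 2)) \<cdot>\<^sub>v u + c \<cdot>\<^sub>v s"
  have x: "x \<in> carrier_vec n"
    using s u by (simp add: x_def)
  have "T *\<^sub>v x = (1 / (b - 2)) \<cdot>\<^sub>v (T *\<^sub>v u) + c \<cdot>\<^sub>v (T *\<^sub>v s)"
    using T s u by (simp add: x_def mult_add_distrib_mat_vec[OF T] mult_mat_vec[OF T])
  also have "\<dots> = u"
  proof (rule eq_vecI)
    fix k
    assume "k < dim_vec u"
    then have k: "k < n"
      by (simp add: u_def)
    have "c * D = (b - bt - 1) / (b - 2)"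
      using \<open>D \<noteq> 0\<close> by (simp add: c_def)
    then have "1 / (b - 2) * (T *\<^sub>v u) $ k + c * (T *\<^sub>v s) $ k = 1"
      unfolding Ts[OF k] Tu[OF k] using assms(2) by (simp add: field_simps)
    then show "((1 / (b - 2)) \<cdot>\<^sub>v (T *\<^sub>v u) + c \<cdot>\<^sub>v (T *\<^sub>v s)) $ k = u $ k"
      using k T by (simp add: u_def)
  qed (use T in \<open>simp add: u_def\<close>)
  finally have "M *\<^sub>v u = x"
    using M_T[OF x] by simp
  \<comment> \<open>After the shift to indices from 0, a row sum of \<open>M\<close> is an entry of
    \<open>M\<close> applied to the all-ones vector.\<close>
  have "(\<Sum>j = 1..n. t_tilde_inv n b bt i j) = (\<Sum>j<n. M $$ (i - 1, j))"
    unfolding t_tilde_inv_def M_def T_def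
    by (rule sum.reindex_bij_witness[of _ Suc "\<lambda>j. j - 1"]) auto
  also have "\<dots> = (M *\<^sub>v u) $ (i - 1)"
    using M assms(4,5) by (simp add: u_def scalar_prod_def atLeast0LessThan)
  also have "\<dots> = 1 / (b - 2) + c * (gam b i + gam b (n + 1 - i))"
  proof -
    \<comment> \<open>Entry \<open>i - 1\<close> of \<open>s\<close> is the term for index
      \<open>i\<close>; the bound 1 \<le> i keeps the subtractions exact.\<close>
    have "Suc (i - 1) = i" "n - (i - 1) = n + 1 - i" "i - 1 < n"
      using assms(4,5) by auto
    then show ?thesis
      unfolding \<open>M *\<^sub>v u = x\<close> by (simp add: x_def u_def s_def del: One_nat_def)
  qed
  finally show ?thesis
    by (simp add: c_def D_def)
qed

end
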